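(* For any numerical semigroup $S$ with multiplicity $m = \mathsf m(S)$, embedding dimension $e = \mathsf e(S)$ and embedding codimension $r = m - e$, the minimal presentation cardinality satisfies $\eta(S) \ge \binom{e}{2} - r$.
   Context: A numerical semigroup is a cofinite subset $S \subseteq \mathbb{Z}_{\ge 0}$ containing $0$ and closed under addition. It has a unique minimal generating set $n_1 < \cdots < n_e$ (its atoms); $\mathsf e(S) = e$ is the embedding dimension and $\mathsf m(S) = n_1$ the multiplicity. The factorization homomorphism $\varphi_S:\mathbb{Z}_{\ge 0}^e \to S$, $z \mapsto z_1n_1 + \cdots + z_en_e$, has kernel the congruence $\ker\varphi_S = \{(z,z') : \varphi_S(z) = \varphi_S(z')\}$. A presentation of $S$ is a subset $\rho \subseteq \ker\varphi_S$ such that the smallest congruence on $\mathbb{Z}_{\ge 0}^e$ containing $\rho$ is $\ker\varphi_S$; it is minimal if no proper subset is a presentation. All minimal presentations have the same cardinality, denoted $\eta(S)$. *)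

theory Defs
  imports Complex_Main
begin

definition submonoid_nat :: "nat set \<Rightarrow> bool" where
  "submonoid_nat T \<longleftrightarrow> 0 \<in> T \<and> (\<forall>x\<in>T. \<forall>y\<in>T. x + y \<in> T)"

definition numerical_semigroup :: "nat set \<Rightarrow> bool" where
  "numerical_semigroup S \<longleftrightarrow> submonoid_nat S \<and> finite (UNIV - S)"

definition generates :: "nat set \<Rightarrow> nat set \<Rightarrow> bool" where
  "generates A S \<longleftrightarrow> submonoid_nat hull A = S"

definition minimal_generating_set :: "nat set \<Rightarrow> nat set \<Rightarrow> bool" where
  "minimal_generating_set S A \<longleftrightarrow> generates A S \<and> (\<forall>B. B \<subset> A \<longrightarrow> \<not> generates B S)"

(* Well defined for submonoids of the naturals, and finite for numerical semigroups:
   see ex1_minimal_generating_set and finite_atoms below. *)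
definition atoms :: "nat set \<Rightarrow> nat set" where
  "atoms S = (THE A. minimal_generating_set S A)"

definition embedding_dim :: "nat set \<Rightarrow> nat" where
  "embedding_dim S = card (atoms S)"

definition semigroup_multiplicity :: "nat set \<Rightarrow> nat" where
  "semigroup_multiplicity S = Min (atoms S)"

(* Coordinates are numbered from 0: atom S i is the (i+1)-st smallest atom, and the free
   commutative monoid of rank e consists of the functions vanishing outside {..<e}. *)
definition atom :: "nat set \<Rightarrow> nat \<Rightarrow> nat" where
  "atom S i = sorted_list_of_set (atoms S) ! i"

definition free_monoid :: "nat \<Rightarrow> (nat \<Rightarrow> nat) set" where
  "free_monoid e = {z. \<forall>i\<ge>e. z i = 0}"

definition factorization_hom :: "nat set \<Rightarrow> (nat \<Rightarrow> nat) \<Rightarrow> nat" where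
  "factorization_hom S z = (\<Sum>i<embedding_dim S. z i * atom S i)"

definition factorization_ker :: "nat set \<Rightarrow> ((nat \<Rightarrow> nat) \<times> (nat \<Rightarrow> nat)) set" where
  "factorization_ker S =
     {(z, z'). z \<in> free_monoid (embedding_dim S) \<and> z' \<in> free_monoid (embedding_dim S) \<and>
               factorization_hom S z = factorization_hom S z'}"

definition congruence_on :: "nat \<Rightarrow> ((nat \<Rightarrow> nat) \<times> (nat \<Rightarrow> nat)) set \<Rightarrow> bool" where
  "congruence_on e R \<longleftrightarrow> equiv (free_monoid e) R \<and>
     (\<forall>(x, y)\<in>R. \<forall>z\<in>free_monoid e. ((\<lambda>i. x i + z i), (\<lambda>i. y i + z i)) \<in> R)"

definition presentation :: "nat set \<Rightarrow> ((nat \<Rightarrow> nat) \<times> (nat \<Rightarrow> nat)) set \<Rightarrow> bool" where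
  "presentation S \<rho> \<longleftrightarrow> \<rho> \<subseteq> factorization_ker S \<and>
     congruence_on (embedding_dim S) hull \<rho> = factorization_ker S"

definition minimal_presentation :: "nat set \<Rightarrow> ((nat \<Rightarrow> nat) \<times> (nat \<Rightarrow> nat)) set \<Rightarrow> bool" where
  "minimal_presentation S \<rho> \<longleftrightarrow> presentation S \<rho> \<and> (\<forall>\<sigma>. \<sigma> \<subset> \<rho> \<longrightarrow> \<not> presentation S \<sigma>)"

(* All minimal presentations of a numerical semigroup are finite of the same cardinality, so
   the choice is immaterial.  Nothing is known about the chosen set beyond its being a minimal
   presentation, hence a lower bound on eta amounts to one for every minimal presentation
   (an infinite one would have card 0). *)
definition eta :: "nat set \<Rightarrow> nat" where
  "eta S = card (SOME \<rho>. minimal_presentation S \<rho>)"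


definition irreducibles :: "nat set \<Rightarrow> nat set" where
  "irreducibles S = {a\<in>S. a \<noteq> 0 \<and> (\<forall>x\<in>S. \<forall>y\<in>S. a = x + y \<longrightarrow> x = 0 \<or> y = 0)}"

lemma submonoid_hull: "submonoid_nat (submonoid_nat hull A)"
  unfolding hull_def submonoid_nat_def by auto

lemma hull_zero: "0 \<in> submonoid_nat hull A"
  and hull_plus: "x \<in> submonoid_nat hull A \<Longrightarrow> y \<in> submonoid_nat hull A \<Longrightarrow> x + y \<in> submonoid_nat hull A"
  using submonoid_hull[of A] unfolding submonoid_nat_def[of "submonoid_nat hull A"] by auto

lemma irreducibles_subset:
  assumes S: "submonoid_nat S" and A: "generates A S"
  shows "irreducibles S \<subseteq> A"
proof
  fix a assume a: "a \<in> irreducibles S"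
  show "a \<in> A"
  proof (rule ccontr)
    assume "a \<notin> A"
    moreover have "A \<subseteq> S"
      using A hull_subset[of A submonoid_nat] by (simp add: generates_def)
    moreover have "submonoid_nat (S - {a})"
      unfolding submonoid_nat_def
    proof (intro conjI ballI)
      show "0 \<in> S - {a}"
        using S a by (auto simp: submonoid_nat_def irreducibles_def)
      fix x y assume xy: "x \<in> S - {a}" "y \<in> S - {a}"
      then have "x + y \<in> S"
        using S by (auto simp: submonoid_nat_def)
      moreover have "x + y \<noteq> a"
      proof
        assume "x + y = a"
        with a xy have "x = 0 \<or> y = 0"
          unfolding irreducibles_def by blast
        with xy \<open>x + y = a\<close> show False by auto
      qed
      ultimately show "x + y \<in> S - {a}" by simp
    qed
    ultimately have "submonoid_nat hull A \<subseteq> S - {a}"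
      by (intro hull_minimal) auto
    then show False
      using a A by (auto simp: generates_def irreducibles_def)
  qed
qed

lemma irreducibles_generate:
  assumes S: "submonoid_nat S"
  shows "generates (irreducibles S) S"
proof -
  let ?H = "submonoid_nat hull irreducibles S"
  have "s \<in> ?H" if "s \<in> S" for s
    using that
  proof (induction s rule: less_induct)
    case (less s)
    show ?case
    proof (cases "s = 0 \<or> s \<in> irreducibles S")
      case True
      then show ?thesis
        using hull_zero hull_inc by auto
    next
      case False
      then obtain x y where "x \<in> S" "y \<in> S" "s = x + y" "x \<noteq> 0" "y \<noteq> 0"
        using less.prems by (auto simp: irreducibles_def)
      with less.IH[of x] less.IH[of y] show ?thesis
        by (auto intro: hull_plus)
    qed
  qed
  moreover have "?H \<subseteq> S"
    using S by (intro hull_minimal) (auto simp: irreducibles_def)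
  ultimately show ?thesis
    by (auto simp: generates_def)
qed

lemma minimal_generating_set_iff:
  assumes "submonoid_nat S"
  shows "minimal_generating_set S A \<longleftrightarrow> A = irreducibles S"
  using irreducibles_subset[OF assms] irreducibles_generate[OF assms]
  unfolding minimal_generating_set_def by blast

lemma ex1_minimal_generating_set: "submonoid_nat S \<Longrightarrow> \<exists>!A. minimal_generating_set S A"
  by (simp add: minimal_generating_set_iff)

lemma atoms_eq_irreducibles: "submonoid_nat S \<Longrightarrow> atoms S = irreducibles S"
  by (simp add: atoms_def minimal_generating_set_iff)

lemma finite_atoms:
  assumes "numerical_semigroup S"
  shows "finite (atoms S)"
proof -
  have S: "submonoid_nat S" and fin: "finite (UNIV - S)"
    using assms by (auto simp: numerical_semigroup_def)
  have "infinite S"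
    using fin by (metis finite_Diff2 infinite_UNIV_nat)
  then obtain m where m: "m \<in> S" "m > 0"
    by (metis finite_nat_set_iff_bounded_le not_gr_zero zero_le)
  have mult: "k * m \<in> S" for k
    using S m by (induction k) (auto simp: submonoid_nat_def)
  have *: "\<not> a < b"
    if a: "a \<in> irreducibles S" and b: "b \<in> irreducibles S" and ab: "a mod m = b mod m" for a b
  proof
    assume "a < b"
    then have "m dvd b - a"
      using ab by (metis mod_eq_dvd_iff_nat less_imp_le)
    then obtain k where "b - a = k * m"
      by (metis dvd_def mult.commute)
    with \<open>a < b\<close> have "b = a + k * m" "k * m \<noteq> 0" by linarith+
    with a b mult[of k] show False
      by (auto simp: irreducibles_def)
  qed
  have "inj_on (\<lambda>a. a mod m) (irreducibles S)"
    by (rule inj_onI) (metis * linorder_neqE_nat)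
  moreover have "(\<lambda>a. a mod m) ` irreducibles S \<subseteq> {..<m}"
    using m by auto
  ultimately show ?thesis
    using S by (metis atoms_eq_irreducibles finite_lessThan inj_on_finite)
qed

end

theory Submission
  imports Defs
begin

text \<open>
  A factorization of length two shares no atom with any other factorization of the same element,
  so a presentation can only reach it through a relation having it as an endpoint. Collapse all
  factorizations other than the \<open>e choose 2\<close> ones of length two that avoid the smallest atom \<open>m\<close>
  to a single vertex. If \<open>b\<close> is the value of such a factorization and \<open>b - m\<close> lies in the
  semigroup, then \<open>b\<close> also has a collapsed factorization; otherwise \<open>b\<close> is an Apery element that is
  neither \<open>0\<close> nor an atom, and there are at most \<open>m - e\<close> of these. Adding one edge for each of them,
  the relations make a connected graph on \<open>(e choose 2) + 1\<close> vertices.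
\<close>

section \<open>Congruences on the free monoid and the hulls generating them\<close>

lemma congruence_on_full: "congruence_on e (free_monoid e \<times> free_monoid e)"
  by (auto simp: congruence_on_def free_monoid_def equiv_def refl_on_def sym_def trans_def)

lemma congruence_on_Inter:
  assumes "\<R> \<noteq> {}" "\<And>R. R \<in> \<R> \<Longrightarrow> congruence_on e R"
  shows "congruence_on e (\<Inter>\<R>)"
proof -
  have eq: "equiv (free_monoid e) R" if "R \<in> \<R>" for R
    using assms(2)[OF that] by (simp add: congruence_on_def)
  have "equiv (free_monoid e) (\<Inter>\<R>)"
  proof (rule equivI)
    show "\<Inter>\<R> \<subseteq> free_monoid e \<times> free_monoid e"
      using assms(1) eq by (auto simp: equiv_def)
    show "refl_on (free_monoid e) (\<Inter>\<R>)"
      using eq by (auto simp: equiv_def refl_on_def)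
    show "sym (\<Inter>\<R>)"
      using eq by (auto simp: equiv_def sym_def)
    show "trans (\<Inter>\<R>)"
      using eq unfolding equiv_def trans_def by blast
  qed
  moreover have "((\<lambda>i. x i + z i), (\<lambda>i. y i + z i)) \<in> \<Inter>\<R>"
    if "(x, y) \<in> \<Inter>\<R>" "z \<in> free_monoid e" for x y z
    using that assms(2) unfolding congruence_on_def by blast
  ultimately show ?thesis
    unfolding congruence_on_def by blast
qed

text \<open>The hypothesis puts the full relation among the congruences being intersected. Over an
  empty family the hull would be \<open>UNIV\<close>, which is no congruence on
  \<open>free_monoid e\<close>.\<close>

lemma congruence_on_hull:
  assumes "\<rho> \<subseteq> free_monoid e \<times> free_monoid e"
  shows "congruence_on e (congruence_on e hull \<rho>)"
  unfolding hull_def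
  by (rule congruence_on_Inter) (use assms congruence_on_full in auto)

text \<open>Hulls of finite subsets form a directed family: two finite witnesses can be merged into
  their union. So the union \<open>K\<close> of these hulls is already a congruence, and since it
  contains \<sigma> it contains the whole hull.\<close>

lemma congruence_hull_finitary:
  assumes \<sigma>: "\<sigma> \<subseteq> free_monoid e \<times> free_monoid e" and p: "p \<in> congruence_on e hull \<sigma>"
  obtains F where "finite F" "F \<subseteq> \<sigma>" "p \<in> congruence_on e hull F"
proof -
  define K where "K = (\<Union>F\<in>{F. finite F \<and> F \<subseteq> \<sigma>}. congruence_on e hull F)"
  have KI: "q \<in> K" if "finite F" "F \<subseteq> \<sigma>" "q \<in> congruence_on e hull F" for q F
    using that unfolding K_def by blast
  have KE: "\<exists>F. finite F \<and> F \<subseteq> \<sigma> \<and> q \<in> congruence_on e hull F" if "q \<in> K" for q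
    using that unfolding K_def by blast
  have cong: "congruence_on e (congruence_on e hull F)" if "F \<subseteq> \<sigma>" for F
    using that \<sigma> by (intro congruence_on_hull) auto
  have eq: "equiv (free_monoid e) (congruence_on e hull F)" if "F \<subseteq> \<sigma>" for F
    using cong[OF that] by (simp add: congruence_on_def)
  have "equiv (free_monoid e) K"
  proof (rule equivI)
    show "K \<subseteq> free_monoid e \<times> free_monoid e"
      using KE eq unfolding equiv_def by blast
    show "refl_on (free_monoid e) K"
      using KI[of "{}"] eq[of "{}"] by (auto simp: equiv_def refl_on_def)
    show "sym K"
    proof (rule symI)
      fix x y assume "(x, y) \<in> K"
      then obtain F where F: "finite F" "F \<subseteq> \<sigma>" "(x, y) \<in> congruence_on e hull F"
        using KE by blast
      with eq[OF F(2)] show "(y, x) \<in> K"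
        by (intro KI[OF F(1,2)]) (auto simp: equiv_def sym_def)
    qed
    show "trans K"
    proof (rule transI)
      fix x y z assume "(x, y) \<in> K" "(y, z) \<in> K"
      then obtain F G where F: "finite F" "F \<subseteq> \<sigma>" "(x, y) \<in> congruence_on e hull F"
        and G: "finite G" "G \<subseteq> \<sigma>" "(y, z) \<in> congruence_on e hull G"
        using KE by meson
      have "(x, y) \<in> congruence_on e hull (F \<union> G)" "(y, z) \<in> congruence_on e hull (F \<union> G)"
        using F G hull_mono[of F "F \<union> G" "congruence_on e"]
          hull_mono[of G "F \<union> G" "congruence_on e"] by auto
      with eq[of "F \<union> G"] F G show "(x, z) \<in> K"
        by (intro KI[of "F \<union> G"]) (auto simp: equiv_def dest: transD)
    qed
  qed
  moreover have "((\<lambda>i. x i + z i), (\<lambda>i. y i + z i)) \<in> K"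
    if xy: "(x, y) \<in> K" and z: "z \<in> free_monoid e" for x y z
  proof -
    obtain F where F: "finite F" "F \<subseteq> \<sigma>" "(x, y) \<in> congruence_on e hull F"
      using KE[OF xy] by blast
    with cong[OF F(2)] z show ?thesis
      by (intro KI[OF F(1,2)]) (auto simp: congruence_on_def)
  qed
  ultimately have "congruence_on e K"
    unfolding congruence_on_def by blast
  moreover have "\<sigma> \<subseteq> K"
  proof
    fix q assume "q \<in> \<sigma>"
    then show "q \<in> K"
      using hull_inc[of q "{q}" "congruence_on e"] by (intro KI[of "{q}"]) auto
  qed
  ultimately have "congruence_on e hull \<sigma> \<subseteq> K"
    by (intro hull_minimal)
  with p KE that show thesis by blast
qed

text \<open>Growing \<open>P\<close> greedily from \<open>v\<close>, every new vertex uses up a new edge.\<close>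

lemma edge_closed_set:
  assumes "finite E"
  obtains P where "v \<in> P" "finite P" "card P \<le> Suc (card E)"
    "\<And>a b. (a, b) \<in> E \<Longrightarrow> a \<in> P \<longleftrightarrow> b \<in> P"
proof -
  \<comment> \<open>A maximal \<open>good\<close> set of edges replaces the greedy process: its
    edges lie inside a vertex set around \<open>v\<close> with at most one vertex more than there
    are edges.\<close>
  define good where "good F \<longleftrightarrow> F \<subseteq> E \<and>
    (\<exists>P. v \<in> P \<and> finite P \<and> F \<subseteq> P \<times> P \<and> card P \<le> Suc (card F))" for F
  have "good {}"
    unfolding good_def by (auto intro!: exI[of _ "{v}"])
  moreover have "finite {F. good F}"
    by (rule finite_subset[of _ "Pow E"]) (use assms in \<open>auto simp: good_def\<close>)
  ultimately obtain F where F: "good F" and max: "\<And>G. good G \<Longrightarrow> F \<subseteq> G \<Longrightarrow> G = F"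
    using finite_has_maximal[of "{F. good F}"] by blast
  from F obtain P where P: "v \<in> P" "finite P" "F \<subseteq> P \<times> P" "card P \<le> Suc (card F)"
    and "F \<subseteq> E"
    unfolding good_def by blast
  have finF: "finite F" and card: "card F \<le> card E"
    using \<open>F \<subseteq> E\<close> assms by (auto intro: finite_subset card_mono)
  have "a \<in> P \<longleftrightarrow> b \<in> P" if ab: "(a, b) \<in> E" for a b
  proof (rule ccontr)
    assume neq: "\<not> (a \<in> P \<longleftrightarrow> b \<in> P)"
    then have new: "(a, b) \<notin> F"
      using P by auto
    \<comment> \<open>An edge leaving \<open>P\<close> has exactly one endpoint outside, so adding
      both endpoints costs one vertex and one edge, and the enlarged set is still
      \<open>good\<close>.\<close>
    have "card (insert a (insert b P)) = Suc (card P)"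
      using neq P(2) by (cases "a \<in> P") (auto simp: insert_absorb insert_commute)
    then have "card (insert a (insert b P)) \<le> Suc (card (insert (a, b) F))"
      using P(4) new finF by simp
    then have "good (insert (a, b) F)"
      unfolding good_def using P \<open>F \<subseteq> E\<close> ab
      by (auto intro!: exI[of _ "insert a (insert b P)"])
    with max new show False by blast
  qed
  with P card that show thesis by simp
qed

section \<open>Vectors of small length and the count of inner pairs\<close>

definition unit_vec :: "nat \<Rightarrow> nat \<Rightarrow> nat" where
  "unit_vec k = (\<lambda>i. if i = k then 1 else 0)"

definition vec_length :: "nat \<Rightarrow> (nat \<Rightarrow> nat) \<Rightarrow> nat" where
  "vec_length e z = (\<Sum>i<e. z i)"

text \<open>Coordinate 0 belongs to the smallest atom, the multiplicity. Repeating the same atom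
  twice is allowed.\<close>

definition inner_pairs :: "nat \<Rightarrow> (nat \<Rightarrow> nat) set" where
  "inner_pairs e = {z \<in> free_monoid e. vec_length e z = 2 \<and> z 0 = 0}"

lemma vec_length_add: "vec_length e (\<lambda>i. x i + y i) = vec_length e x + vec_length e y"
  by (simp add: vec_length_def sum.distrib)

lemma vec_length_unit_vec: "k < e \<Longrightarrow> vec_length e (unit_vec k) = 1"
  by (simp add: vec_length_def unit_vec_def)

lemma unit_vec_free: "k < e \<Longrightarrow> unit_vec k \<in> free_monoid e"
  by (auto simp: unit_vec_def free_monoid_def)

lemma add_free: "x \<in> free_monoid e \<Longrightarrow> y \<in> free_monoid e \<Longrightarrow> (\<lambda>i. x i + y i) \<in> free_monoid e"
  by (auto simp: free_monoid_def)

lemma vec_length_eq_0: "z \<in> free_monoid e \<Longrightarrow> vec_length e z = 0 \<longleftrightarrow> z = (\<lambda>_. 0)"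
  by (force simp: vec_length_def free_monoid_def fun_eq_iff not_less[symmetric])

lemma split_unit_vec:
  assumes "z \<in> free_monoid e" "z k > 0"
  obtains w where "k < e" "w \<in> free_monoid e" "z = (\<lambda>i. w i + unit_vec k i)"
proof
  show "k < e"
    using assms by (auto simp: free_monoid_def) (metis not_le less_irrefl)
  show "(\<lambda>i. z i - unit_vec k i) \<in> free_monoid e"
    using assms by (auto simp: free_monoid_def)
  show "z = (\<lambda>i. z i - unit_vec k i + unit_vec k i)"
    using assms by (auto simp: unit_vec_def)
qed

lemma nonzero_split_unit_vec:
  assumes "z \<in> free_monoid e" "z \<noteq> (\<lambda>_. 0)"
  obtains k w where "k < e" "w \<in> free_monoid e" "z = (\<lambda>i. w i + unit_vec k i)"
proof -
  obtain k where "z k > 0"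
    using assms(2) by (auto simp: fun_eq_iff)
  from split_unit_vec[OF assms(1) this] that show thesis by blast
qed

lemma finite_bounded_free: "finite {z \<in> free_monoid e. \<forall>i<e. z i \<le> N}"
proof (rule finite_subset)
  show "{z \<in> free_monoid e. \<forall>i<e. z i \<le> N} \<subseteq>
      {f. \<forall>x. (x \<in> {..<e} \<longrightarrow> f x \<in> {..N}) \<and> (x \<notin> {..<e} \<longrightarrow> f x = 0)}"
    by (auto simp: free_monoid_def)
  show "finite {f. \<forall>x. (x \<in> {..<e} \<longrightarrow> f x \<in> {..N}) \<and> (x \<notin> {..<e} \<longrightarrow> f x = (0::nat))}"
    by (rule finite_set_of_finite_funs) auto
qed

lemma finite_inner_pairs: "finite (inner_pairs e)"
proof (rule finite_subset[OF _ finite_bounded_free])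
  show "inner_pairs e \<subseteq> {z \<in> free_monoid e. \<forall>i<e. z i \<le> 2}"
  proof clarify
    fix z assume z: "z \<in> inner_pairs e"
    have "z i \<le> vec_length e z" if "i < e" for i
      unfolding vec_length_def using that by (intro member_le_sum) auto
    with z show "z \<in> free_monoid e \<and> (\<forall>i<e. z i \<le> 2)"
      by (simp add: inner_pairs_def)
  qed
qed

text \<open>An inner pair is a sum of two unit vectors with indices
  \<open>1 \<le> i \<le> j < e\<close>. Its support \<open>{i, j}\<close> together with the order of
  the indices recovers the pair, and each \<open>j\<close> admits exactly \<open>j\<close> values of
  \<open>i\<close>.\<close>

lemma card_inner_pairs: "e choose 2 \<le> card (inner_pairs e)"
proof -
  define f where "f = (\<lambda>(j, i). \<lambda>k. unit_vec i k + unit_vec j k)"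
  let ?D = "SIGMA j:{..<e}. {1..j}"
  have supp: "{k. f (j, i) k \<noteq> 0} = {i, j}" for i j
    by (auto simp: f_def unit_vec_def)
  have "inj_on f ?D"
  proof (rule inj_onI, clarify)
    fix j i j' i' assume *: "i \<in> {1..j}" "i' \<in> {1..j'}" "f (j, i) = f (j', i')"
    then have "{i, j} = {i', j'}"
      using supp by metis
    with * show "j = j' \<and> i = i'"
      by (auto simp: doubleton_eq_iff)
  qed
  moreover have "f ` ?D \<subseteq> inner_pairs e"
    by (auto simp: f_def inner_pairs_def add_free unit_vec_free vec_length_add vec_length_unit_vec)
      (auto simp: unit_vec_def)
  ultimately have "card ?D \<le> card (inner_pairs e)"
    by (intro card_inj_on_le finite_inner_pairs)
  moreover have "card ?D = (\<Sum>j<e. j)"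
    by simp
  moreover have "(\<Sum>j<e. j) = e choose 2"
    by (induction e) (simp_all add: numeral_2_eq_2)
  ultimately show ?thesis by simp
qed

section \<open>The factorization homomorphism, its kernel and minimal presentations\<close>

lemma factorization_hom_add:
  "factorization_hom S (\<lambda>i. x i + y i) = factorization_hom S x + factorization_hom S y"
  by (simp add: factorization_hom_def sum.distrib algebra_simps)

lemma factorization_hom_unit_vec:
  "k < embedding_dim S \<Longrightarrow> factorization_hom S (unit_vec k) = atom S k"
  by (simp add: factorization_hom_def unit_vec_def if_distribR if_distrib[of "\<lambda>x. x * _"] cong: if_cong)

lemma factorization_hom_zero: "factorization_hom S (\<lambda>_. 0) = 0"
  by (simp add: factorization_hom_def)

lemma congruence_factorization_ker: "congruence_on (embedding_dim S) (factorization_ker S)"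
  unfolding congruence_on_def
proof (intro conjI)
  show "equiv (free_monoid (embedding_dim S)) (factorization_ker S)"
    by (auto simp: equiv_def refl_on_def sym_def trans_def factorization_ker_def)
qed (auto simp: factorization_ker_def add_free factorization_hom_add)

text \<open>Finitely many subsets of \<rho> are candidates, so an inclusion-minimal one exists. This
  makes the choice in \<open>eta\<close> meaningful.\<close>

lemma finite_presentation_contains_minimal:
  assumes "finite \<rho>" "presentation S \<rho>"
  shows "\<exists>\<sigma>. minimal_presentation S \<sigma>"
proof -
  let ?\<P> = "{\<sigma>. \<sigma> \<subseteq> \<rho> \<and> presentation S \<sigma>}"
  have "finite ?\<P>" "?\<P> \<noteq> {}"
    using assms by auto
  from finite_has_minimal[OF this]
  obtain \<sigma> where \<sigma>: "\<sigma> \<in> ?\<P>" "\<forall>\<tau>\<in>?\<P>. \<tau> \<subseteq> \<sigma> \<longrightarrow> \<sigma> = \<tau>" ..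
  then have "minimal_presentation S \<sigma>"
    unfolding minimal_presentation_def by blast
  then show ?thesis ..
qed

text \<open>Each of the finitely many relations in \<rho> follows from finitely many relations in
  \<sigma>. Together these form a finite presentation inside \<sigma>, which is all of \<sigma> by
  minimality. Finiteness matters because \<open>card\<close> is 0 on infinite sets.\<close>

lemma finite_minimal_presentation:
  assumes \<rho>: "finite \<rho>" "presentation S \<rho>" and \<sigma>: "minimal_presentation S \<sigma>"
  shows "finite \<sigma>"
proof -
  let ?e = "embedding_dim S"
  have pres: "\<sigma> \<subseteq> factorization_ker S" "congruence_on ?e hull \<sigma> = factorization_ker S"
    using \<sigma> by (auto simp: minimal_presentation_def presentation_def)
  have ker: "factorization_ker S \<subseteq> free_monoid ?e \<times> free_monoid ?e"
    by (auto simp: factorization_ker_def)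
  have "\<exists>F. finite F \<and> F \<subseteq> \<sigma> \<and> p \<in> congruence_on ?e hull F" if "p \<in> \<rho>" for p
  proof -
    have "p \<in> congruence_on ?e hull \<sigma>"
      using \<rho> that pres by (auto simp: presentation_def)
    moreover have "\<sigma> \<subseteq> free_monoid ?e \<times> free_monoid ?e"
      using pres ker by blast
    ultimately show ?thesis
      using congruence_hull_finitary by metis
  qed
  then obtain F where F: "\<And>p. p \<in> \<rho> \<Longrightarrow> finite (F p) \<and> F p \<subseteq> \<sigma> \<and> p \<in> congruence_on ?e hull F p"
    by metis
  let ?G = "\<Union>(F ` \<rho>)"
  have G: "finite ?G" "?G \<subseteq> \<sigma>"
    using F \<rho>(1) by auto
  have "\<rho> \<subseteq> congruence_on ?e hull ?G"
    using F hull_mono[of _ ?G "congruence_on ?e"] by blast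
  moreover have "congruence_on ?e (congruence_on ?e hull ?G)"
    using G pres ker by (intro congruence_on_hull) blast
  ultimately have "congruence_on ?e hull \<rho> \<subseteq> congruence_on ?e hull ?G"
    by (rule hull_minimal)
  moreover have "congruence_on ?e hull ?G \<subseteq> congruence_on ?e hull \<sigma>"
    using G by (intro hull_mono)
  ultimately have "presentation S ?G"
    using pres G \<rho>(2) unfolding presentation_def by blast
  with \<sigma> G have "?G = \<sigma>"
    unfolding minimal_presentation_def by blast
  with G show ?thesis by simp
qed

section \<open>Factorizations in a fixed numerical semigroup\<close>

context
  fixes S :: "nat set"
  assumes ns: "numerical_semigroup S"
begin

lemma submonoid: "submonoid_nat S"
  using ns by (simp add: numerical_semigroup_def)

lemma atom_bij: "bij_betw (atom S) {..<embedding_dim S} (atoms S)"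
  unfolding embedding_dim_def atom_def
  by (rule bij_betw_nth) (auto simp: finite_atoms[OF ns])

lemma atom_irreducible: "k < embedding_dim S \<Longrightarrow> atom S k \<in> irreducibles S"
  using atom_bij atoms_eq_irreducibles[OF submonoid] by (auto simp: bij_betw_def)

lemma atom_in: "k < embedding_dim S \<Longrightarrow> atom S k \<in> S"
  and atom_pos: "k < embedding_dim S \<Longrightarrow> atom S k > 0"
  using atom_irreducible by (auto simp: irreducibles_def)

lemma irreducible_sumD:
  "a \<in> irreducibles S \<Longrightarrow> a = x + y \<Longrightarrow> x \<in> S \<Longrightarrow> y \<in> S \<Longrightarrow> x = 0 \<or> y = 0"
  by (simp add: irreducibles_def)

lemma infinite_semigroup: "infinite S"
  using ns by (metis numerical_semigroup_def finite_Diff2 infinite_UNIV_nat)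

lemma factorization_exists:
  "s \<in> S \<Longrightarrow> \<exists>z\<in>free_monoid (embedding_dim S). factorization_hom S z = s"
proof (induction s rule: less_induct)
  case (less s)
  consider "s = 0" | "s \<in> irreducibles S" |
    x y where "x \<in> S" "y \<in> S" "s = x + y" "x \<noteq> 0" "y \<noteq> 0"
    using less.prems by (auto simp: irreducibles_def)
  then show ?case
  proof cases
    case 1
    then show ?thesis
      by (intro bexI[of _ "\<lambda>_. 0"]) (auto simp: factorization_hom_zero free_monoid_def)
  next
    case 2
    then obtain k where "k < embedding_dim S" "s = atom S k"
      using atom_bij atoms_eq_irreducibles[OF submonoid] by (auto simp: bij_betw_def)
    then show ?thesis
      by (intro bexI[of _ "unit_vec k"]) (auto simp: factorization_hom_unit_vec unit_vec_free)
  next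
    case 3
    then obtain u w where "u \<in> free_monoid (embedding_dim S)" "factorization_hom S u = x"
      "w \<in> free_monoid (embedding_dim S)" "factorization_hom S w = y"
      using less.IH[of x] less.IH[of y] by auto
    then show ?thesis
      using 3 by (intro bexI[of _ "\<lambda>i. u i + w i"]) (auto simp: factorization_hom_add add_free)
  qed
qed

lemma embedding_dim_pos: "embedding_dim S > 0"
proof (rule ccontr)
  assume "\<not> ?thesis"
  then have "s = 0" if "s \<in> S" for s
    using factorization_exists[OF that] by (auto simp: factorization_hom_def)
  then have "S \<subseteq> {0}" by auto
  then show False
    using infinite_semigroup finite_subset by blast
qed

lemma atom_0: "atom S 0 = semigroup_multiplicity S"
proof -
  have "atoms S \<noteq> {}"
    using embedding_dim_pos by (auto simp: embedding_dim_def)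
  then show ?thesis
    by (simp add: atom_def semigroup_multiplicity_def finite_atoms[OF ns]
        sorted_list_of_set_nonempty)
qed

lemma factorization_hom_in: "factorization_hom S z \<in> S"
proof -
  have "k * a \<in> S" if "a \<in> S" for k a
    using submonoid that by (induction k) (auto simp: submonoid_nat_def)
  \<comment> \<open>The induction runs over truncated sums with \<open>n\<close> at most the
    embedding dimension, since \<open>atom_in\<close> covers only the indices below it.\<close>
  then have "(\<Sum>i<n. z i * atom S i) \<in> S" if "n \<le> embedding_dim S" for n
    using that submonoid atom_in by (induction n) (auto simp: submonoid_nat_def)
  then show ?thesis
    by (simp add: factorization_hom_def)
qed

lemma coefficient_le_hom:
  assumes "i < embedding_dim S"
  shows "z i \<le> factorization_hom S z"
proof -
  have "z i \<le> z i * atom S i"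
    using atom_pos[OF assms] by simp
  also have "\<dots> \<le> factorization_hom S z"
    unfolding factorization_hom_def using assms
    by (intro member_le_sum[of i "{..<embedding_dim S}" "\<lambda>i. z i * atom S i"]) auto
  finally show ?thesis .
qed

lemma factorization_hom_eq_0:
  assumes "z \<in> free_monoid (embedding_dim S)"
  shows "factorization_hom S z = 0 \<longleftrightarrow> z = (\<lambda>_. 0)"
proof
  assume zero: "factorization_hom S z = 0"
  show "z = (\<lambda>_. 0)"
  proof
    fix i
    show "z i = 0"
      using coefficient_le_hom[of i z] zero assms
      by (cases "i < embedding_dim S") (auto simp: free_monoid_def)
  qed
qed (simp add: factorization_hom_zero)

text \<open>A vector of length at most one represents 0 or an atom. Positivity of the atoms settles
  0, and irreducibility settles an atom: splitting one atom off \<open>y\<close> must leave value 0.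
  This is what isolates factorizations of length two.\<close>

lemma short_factorization_unique:
  assumes ker: "(x, y) \<in> factorization_ker S" and len: "vec_length (embedding_dim S) x \<le> 1"
  shows "y = x"
proof -
  let ?e = "embedding_dim S"
  have free: "x \<in> free_monoid ?e" "y \<in> free_monoid ?e"
    and eq: "factorization_hom S x = factorization_hom S y"
    using ker by (auto simp: factorization_ker_def)
  show ?thesis
  proof (cases "x = (\<lambda>_. 0)")
    case True
    then show ?thesis
      using eq factorization_hom_eq_0 free factorization_hom_zero by metis
  next
    case False
    then obtain k w where k: "k < ?e" "w \<in> free_monoid ?e" "x = (\<lambda>i. w i + unit_vec k i)"
      using nonzero_split_unit_vec free by metis
    then have "vec_length ?e w = 0"
      using len by (simp add: vec_length_add vec_length_unit_vec)
    then have x: "x = unit_vec k"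
      using k by (auto simp: vec_length_eq_0)
    have "y \<noteq> (\<lambda>_. 0)"
      using False eq factorization_hom_eq_0 free factorization_hom_zero by metis
    then obtain l v where l: "l < ?e" "v \<in> free_monoid ?e" "y = (\<lambda>i. v i + unit_vec l i)"
      using nonzero_split_unit_vec free by metis
    have *: "atom S k = factorization_hom S v + atom S l"
      using eq x k l by (simp add: factorization_hom_add factorization_hom_unit_vec)
    moreover have "atom S l \<noteq> 0"
      using atom_pos[OF l(1)] by simp
    ultimately have "factorization_hom S v = 0"
      using irreducible_sumD[OF atom_irreducible[OF k(1)] * factorization_hom_in atom_in[OF l(1)]]
      by simp
    moreover from this have "k = l"
      using * atom_bij k(1) l(1) by (auto simp: bij_betw_def inj_on_def)
    ultimately show ?thesis
      using x l factorization_hom_eq_0 by auto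
  qed
qed

text \<open>
  The relations between factorizations of small elements suffice: if two factorizations of a large
  element involve the atoms \<open>a\<close> and \<open>b\<close>, both share an atom with a third one that involves \<open>a\<close> and
  \<open>b\<close>, and cancelling the shared atom gives relations between smaller elements.
\<close>

lemma finite_presentation_exists: "\<exists>\<rho>. finite \<rho> \<and> presentation S \<rho>"
proof -
  let ?e = "embedding_dim S"
  have "finite (UNIV - S)"
    using ns by (simp add: numerical_semigroup_def)
  then obtain c where gap: "\<And>n. n \<in> UNIV - S \<Longrightarrow> n < c"
    using finite_nat_set_iff_bounded[of "UNIV - S"] by blast
  have c: "n \<in> S" if "n \<ge> c" for n
    using that gap[of n] by fastforce
  define M where "M = (\<Sum>i<?e. atom S i)"
  have M: "atom S k \<le> M" if "k < ?e" for k
    unfolding M_def using that by (intro member_le_sum) auto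
  \<comment> \<open>Two atoms sum to at most \<open>2 * M\<close>, so a value above \<open>N\<close>
    is still at least \<open>c\<close> after both are subtracted, hence still in
    \<open>S\<close>.\<close>
  define N where "N = c + 2 * M"
  define \<rho> where "\<rho> = {(x, y) \<in> factorization_ker S. factorization_hom S x \<le> N}"
  have bound: "\<forall>i<?e. z i \<le> N" if "factorization_hom S z \<le> N" for z
    using coefficient_le_hom that order_trans by blast
  have "\<rho> \<subseteq> {z \<in> free_monoid ?e. \<forall>i<?e. z i \<le> N} \<times> {z \<in> free_monoid ?e. \<forall>i<?e. z i \<le> N}"
    unfolding \<rho>_def factorization_ker_def by (auto simp: bound)
  then have "finite \<rho>"
    by (rule finite_subset) (intro finite_cartesian_product finite_bounded_free)
  moreover have "factorization_ker S \<subseteq> R" if R: "congruence_on ?e R" "\<rho> \<subseteq> R" for R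
  proof -
    have tr: "trans R" and
      add: "\<And>x y z. (x, y) \<in> R \<Longrightarrow> z \<in> free_monoid ?e \<Longrightarrow> ((\<lambda>i. x i + z i), (\<lambda>i. y i + z i)) \<in> R"
      using R(1) by (auto simp: congruence_on_def equiv_def)
    have "(x, y) \<in> R" if "(x, y) \<in> factorization_ker S" "factorization_hom S x = b" for x y b
      using that
    proof (induction b arbitrary: x y rule: less_induct)
      case (less b)
      have xy: "x \<in> free_monoid ?e" "y \<in> free_monoid ?e" "factorization_hom S y = b"
        using less.prems by (auto simp: factorization_ker_def)
      show ?case
      proof (cases "b \<le> N")
        case True
        then show ?thesis
          using less.prems R(2) by (auto simp: \<rho>_def)
      next
        case False
        then have "x \<noteq> (\<lambda>_. 0)" "y \<noteq> (\<lambda>_. 0)"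
          using less.prems xy factorization_hom_zero[of S] by auto
        then obtain k u l v where
          k: "k < ?e" "u \<in> free_monoid ?e" "x = (\<lambda>i. u i + unit_vec k i)" and
          l: "l < ?e" "v \<in> free_monoid ?e" "y = (\<lambda>i. v i + unit_vec l i)"
          using nonzero_split_unit_vec[OF xy(1)] nonzero_split_unit_vec[OF xy(2)] by metis
        have bk: "b = factorization_hom S u + atom S k" and bl: "b = factorization_hom S v + atom S l"
          using k l less.prems(2) xy(3) by (simp_all add: factorization_hom_add factorization_hom_unit_vec)
        have big: "b \<ge> c + atom S k + atom S l"
          using False M[OF k(1)] M[OF l(1)] by (simp add: N_def)
        then have "b - atom S k - atom S l \<in> S"
          by (intro c) simp
        then obtain w where w: "w \<in> free_monoid ?e" "factorization_hom S w = b - atom S k - atom S l"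
          using factorization_exists by blast
        define w1 where "w1 = (\<lambda>i. w i + unit_vec l i)"
        define w2 where "w2 = (\<lambda>i. w i + unit_vec k i)"
        have "(u, w1) \<in> factorization_ker S"
          unfolding factorization_ker_def w1_def using k l w bk big
          by (simp add: add_free unit_vec_free factorization_hom_add factorization_hom_unit_vec)
        moreover have "(w2, v) \<in> factorization_ker S"
          unfolding factorization_ker_def w2_def using k l w bl big
          by (simp add: add_free unit_vec_free factorization_hom_add factorization_hom_unit_vec)
        moreover have "factorization_hom S u < b"
          using bk atom_pos[OF k(1)] by simp
        moreover have "factorization_hom S w2 = factorization_hom S v"
          using calculation(2) by (simp add: factorization_ker_def)
        moreover have "factorization_hom S v < b"
          using bl atom_pos[OF l(1)] by simp
        ultimately have "(u, w1) \<in> R" "(w2, v) \<in> R"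
          using less.IH by auto
        then have "((\<lambda>i. u i + unit_vec k i), (\<lambda>i. w1 i + unit_vec k i)) \<in> R"
          "((\<lambda>i. w2 i + unit_vec l i), (\<lambda>i. v i + unit_vec l i)) \<in> R"
          using add k(1) l(1) unit_vec_free by auto
        \<comment> \<open>Both sides are \<open>w\<close> plus the unit vectors of \<open>k\<close>
          and \<open>l\<close>, the intermediate factorization linking \<open>x\<close> to
          \<open>y\<close>.\<close>
        moreover have "(\<lambda>i. w1 i + unit_vec k i) = (\<lambda>i. w2 i + unit_vec l i)"
          by (simp add: w1_def w2_def add_ac)
        ultimately show ?thesis
          using tr k(3) l(3) by (metis transD)
      qed
    qed
    then show ?thesis by auto
  qed
  then have "factorization_ker S \<subseteq> congruence_on ?e hull \<rho>"
    unfolding hull_def by blast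
  moreover have "\<rho> \<subseteq> factorization_ker S"
    by (auto simp: \<rho>_def)
  moreover have "congruence_on ?e hull \<rho> \<subseteq> factorization_ker S"
    using calculation(3) congruence_factorization_ker by (intro hull_minimal)
  ultimately show ?thesis
    unfolding presentation_def by blast
qed

section \<open>Counting the Apery elements that are values of inner pairs\<close>

text \<open>The Apery condition with respect to the multiplicity is written additively to keep
  truncated subtraction out.\<close>

definition inner_apery :: "nat set" where
  "inner_apery = {b \<in> factorization_hom S ` inner_pairs (embedding_dim S).
     \<forall>s\<in>S. b \<noteq> s + semigroup_multiplicity S}"

text \<open>Apery elements are pairwise incongruent modulo the multiplicity, so there are at most
  that many. Besides the inner ones, 0 and the \<open>e - 1\<close> atoms other than the smallest
  are Apery elements, which accounts for the summand \<open>embedding_dim S\<close>.\<close>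

lemma card_inner_apery:
  "card inner_apery + embedding_dim S \<le> semigroup_multiplicity S"
proof -
  let ?e = "embedding_dim S" and ?m = "semigroup_multiplicity S"
  let ?A = "atom S ` {1..<?e}"
  have m: "?m > 0" "?m \<in> S"
    using atom_0 atom_pos atom_in embedding_dim_pos by metis+
  have inj: "inj_on (atom S) {..<?e}"
    using atom_bij by (simp add: bij_betw_def)
  have apery: "b \<in> S \<and> (\<forall>s\<in>S. b \<noteq> s + ?m)" if "b \<in> inner_apery \<union> insert 0 ?A" for b
  proof -
    consider "b \<in> inner_apery" | "b = 0" | k where "1 \<le> k" "k < ?e" "b = atom S k"
      using \<open>b \<in> _\<close> by auto
    then show ?thesis
    proof cases
      case 1
      then show ?thesis
        using factorization_hom_in by (auto simp: inner_apery_def)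
    next
      case 2
      then show ?thesis
        using m submonoid by (auto simp: submonoid_nat_def)
    next
      case 3
      have "b \<noteq> s + ?m" if "s \<in> S" for s
      proof
        assume "b = s + ?m"
        with irreducible_sumD[OF atom_irreducible[OF 3(2)] _ that m(2)] 3(3) m(1) have "s = 0"
          by simp
        with \<open>b = s + ?m\<close> 3 have "atom S k = atom S 0"
          by (simp add: atom_0)
        with inj 3 show False
          using embedding_dim_pos by (auto dest: inj_onD)
      qed
      with 3 atom_in show ?thesis by auto
    qed
  qed
  have mult: "k * ?m \<in> S" for k
    using submonoid m by (induction k) (auto simp: submonoid_nat_def)
  have *: "\<not> a < b"
    if a: "a \<in> inner_apery \<union> insert 0 ?A" and b: "b \<in> inner_apery \<union> insert 0 ?A"
      and ab: "a mod ?m = b mod ?m" for a b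
  proof
    assume "a < b"
    then have "?m dvd b - a"
      using ab by (metis mod_eq_dvd_iff_nat less_imp_le)
    then obtain k where k: "b - a = k * ?m"
      by (metis dvd_def mult.commute)
    with \<open>a < b\<close> obtain k' where "k = Suc k'"
      by (cases k) auto
    \<comment> \<open>The larger of two congruent elements is the smaller plus a positive multiple
      of the multiplicity. Setting one copy aside leaves a remainder in \<open>S\<close>, contrary
      to the Apery property of \<open>b\<close>.\<close>
    with k \<open>a < b\<close> have "b = (a + k' * ?m) + ?m"
      by simp
    moreover have "a + k' * ?m \<in> S"
      using apery[OF a] mult submonoid by (auto simp: submonoid_nat_def)
    ultimately show False
      using apery[OF b] by blast
  qed
  have "inj_on (\<lambda>b. b mod ?m) (inner_apery \<union> insert 0 ?A)"
    by (rule inj_onI) (metis * linorder_neqE_nat)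
  moreover have "(\<lambda>b. b mod ?m) ` (inner_apery \<union> insert 0 ?A) \<subseteq> {..<?m}"
    using m by auto
  ultimately have le: "card (inner_apery \<union> insert 0 ?A) \<le> ?m"
    using card_inj_on_le[OF _ _ finite_lessThan] card_lessThan by metis
  \<comment> \<open>Disjointness: 0 and the atoms have a factorization of length at most one, which
    is then the only one, whereas \<open>b\<close> has one of length two.\<close>
  have "b \<notin> insert 0 ?A" if inner: "b \<in> inner_apery" for b
  proof
    assume b: "b \<in> insert 0 ?A"
    obtain t where t: "t \<in> inner_pairs ?e" "b = factorization_hom S t"
      using inner by (auto simp: inner_apery_def)
    obtain x where x: "x \<in> free_monoid ?e" "vec_length ?e x \<le> 1" "factorization_hom S x = b"
    proof (cases "b = 0")
      case True
      then show ?thesis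
        by (intro that[of "\<lambda>_. 0"]) (auto simp: free_monoid_def vec_length_def factorization_hom_zero)
    next
      case False
      then obtain k where "k < ?e" "b = atom S k"
        using b by auto
      then show ?thesis
        by (intro that[of "unit_vec k"])
          (auto simp: unit_vec_free vec_length_unit_vec factorization_hom_unit_vec)
    qed
    with t have "(x, t) \<in> factorization_ker S"
      by (auto simp: factorization_ker_def inner_pairs_def)
    with x have "t = x"
      by (intro short_factorization_unique)
    with x t show False
      by (simp add: inner_pairs_def)
  qed
  then have "inner_apery \<inter> insert 0 ?A = {}"
    by blast
  moreover have "finite inner_apery"
    unfolding inner_apery_def by (simp add: finite_inner_pairs)
  ultimately have "card (inner_apery \<union> insert 0 ?A) = card inner_apery + card (insert 0 ?A)"
    by (intro card_Un_disjoint) auto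
  moreover have "0 \<notin> ?A"
    using atom_pos by fastforce
  moreover have "card ?A = ?e - 1"
    using inj by (subst card_image) (auto intro: inj_on_subset)
  ultimately show ?thesis
    using le embedding_dim_pos by simp
qed

section \<open>The graph argument bounding every finite presentation\<close>

text \<open>Agreement of \<open>c x\<close> and \<open>c y\<close> about membership in an
  edge-closed set \<open>P\<close> defines a congruence. It contains \<rho>, hence the whole kernel,
  and this forces every inner pair into \<open>P\<close>, whose size is bounded by the number of
  edges plus one.\<close>

lemma presentation_card_ge:
  assumes fin: "finite \<rho>" and pres: "presentation S \<rho>"
  shows "embedding_dim S choose 2 \<le> card \<rho> + card inner_apery"
proof -
  let ?e = "embedding_dim S" and ?m = "semigroup_multiplicity S"
  let ?T = "inner_pairs ?e"
  \<comment> \<open>The zero vector is not an inner pair, so it can serve as the single vertex to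
    which all other vectors are collapsed.\<close>
  define c where "c x = (if x \<in> ?T then x else (\<lambda>_. 0))" for x
  have zero: "(\<lambda>_. 0) \<notin> ?T"
    by (simp add: inner_pairs_def vec_length_def)
  \<comment> \<open>One representative per Apery value suffices: the kernel then links it to every
    other inner pair with the same value.\<close>
  define t where "t b = (SOME t. t \<in> ?T \<and> factorization_hom S t = b)" for b
  have t: "t b \<in> ?T \<and> factorization_hom S (t b) = b" if "b \<in> inner_apery" for b
  proof -
    have "\<exists>t. t \<in> ?T \<and> factorization_hom S t = b"
      using that by (auto simp: inner_apery_def)
    then show ?thesis
      unfolding t_def by (rule someI_ex)
  qed
  define E where "E = map_prod c c ` \<rho> \<union> (\<lambda>b. (t b, \<lambda>_. 0)) ` inner_apery"
  have fin_apery: "finite inner_apery"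
    unfolding inner_apery_def by (simp add: finite_inner_pairs)
  have finE: "finite E"
    using fin fin_apery by (simp add: E_def)
  have cardE: "card E \<le> card \<rho> + card inner_apery"
    unfolding E_def using fin fin_apery
    by (intro order_trans[OF card_Un_le] add_mono card_image_le)
  obtain P where P: "(\<lambda>_. 0) \<in> P" "finite P" "card P \<le> Suc (card E)"
    and closed: "\<And>a b. (a, b) \<in> E \<Longrightarrow> a \<in> P \<longleftrightarrow> b \<in> P"
    using edge_closed_set[OF finE, of "\<lambda>_. 0"] by blast
  define K where "K = {(x, y) \<in> factorization_ker S. c x \<in> P \<longleftrightarrow> c y \<in> P}"
  have "congruence_on ?e K"
    unfolding congruence_on_def
  proof (intro conjI)
    show "equiv (free_monoid ?e) K"
      by (auto simp: equiv_def refl_on_def sym_def trans_def K_def factorization_ker_def)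
    have sum: "((\<lambda>i. x i + z i), (\<lambda>i. y i + z i)) \<in> K"
      if xy: "(x, y) \<in> K" and z: "z \<in> free_monoid ?e" for x y z
    proof -
      have ker: "(x, y) \<in> factorization_ker S" "(y, x) \<in> factorization_ker S"
        using xy by (auto simp: K_def factorization_ker_def)
      have ker': "((\<lambda>i. x i + z i), (\<lambda>i. y i + z i)) \<in> factorization_ker S"
        using ker z by (simp add: factorization_ker_def add_free factorization_hom_add)
      have short: "vec_length ?e u \<le> 1" if "(\<lambda>i. u i + z i) \<in> ?T" "z \<noteq> (\<lambda>_. 0)" for u
      proof -
        have "vec_length ?e z > 0"
          using vec_length_eq_0[OF z] that(2) by simp
        with that(1) show ?thesis
          by (simp add: inner_pairs_def vec_length_add)
      qed
      \<comment> \<open>If \<open>z\<close> is nonzero and one of the two sums is an inner pair, the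
        vector it was added to has length at most one, and uniqueness gives \<open>x = y\<close>.
        Otherwise both sums collapse to the same vertex.\<close>
      consider "z = (\<lambda>_. 0)" | "x = y" | "(\<lambda>i. x i + z i) \<notin> ?T" "(\<lambda>i. y i + z i) \<notin> ?T"
        using short short_factorization_unique[OF ker(1)] short_factorization_unique[OF ker(2)]
        by blast
      then show ?thesis
      proof cases
        case 1
        then show ?thesis
          using xy by simp
      next
        case 2
        then show ?thesis
          using ker' by (simp add: K_def)
      next
        case 3
        then show ?thesis
          using ker' by (simp add: K_def c_def)
      qed
    qed
    then show "\<forall>(x, y)\<in>K. \<forall>z\<in>free_monoid ?e. ((\<lambda>i. x i + z i), (\<lambda>i. y i + z i)) \<in> K"
      by blast
  qed
  moreover have "\<rho> \<subseteq> K"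
  proof clarify
    fix x y assume xy: "(x, y) \<in> \<rho>"
    then have "(c x, c y) \<in> E"
      unfolding E_def by force
    with xy pres closed show "(x, y) \<in> K"
      by (auto simp: K_def presentation_def)
  qed
  ultimately have "congruence_on ?e hull \<rho> \<subseteq> K"
    by (intro hull_minimal)
  then have K: "c x \<in> P \<longleftrightarrow> c y \<in> P" if "(x, y) \<in> factorization_ker S" for x y
    using that pres by (auto simp: presentation_def K_def)
  have "x \<in> P" if x: "x \<in> ?T" for x
  proof -
    have free: "x \<in> free_monoid ?e"
      using x by (simp add: inner_pairs_def)
    \<comment> \<open>It is enough to find some factorization of the same value whose collapsed
      vertex lies in \<open>P\<close>, since \<open>K\<close> then transfers membership to
      \<open>x\<close>.\<close>
    have "\<exists>y\<in>free_monoid ?e. factorization_hom S y = factorization_hom S x \<and> c y \<in> P"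
    proof (cases "factorization_hom S x \<in> inner_apery")
      case True
      from t[OF True] have "(t (factorization_hom S x), \<lambda>_. 0) \<in> E"
        using True by (auto simp: E_def)
      with closed P(1) have "t (factorization_hom S x) \<in> P"
        by blast
      with t[OF True] show ?thesis
        by (intro bexI[of _ "t (factorization_hom S x)"]) (auto simp: c_def inner_pairs_def)
    next
      case False
      then obtain s where s: "s \<in> S" "factorization_hom S x = s + ?m"
        using x by (auto simp: inner_apery_def)
      then obtain w where w: "w \<in> free_monoid ?e" "factorization_hom S w = s"
        using factorization_exists by blast
      \<comment> \<open>A factorization using the smallest atom has a nonzero coordinate 0, so it is
        no inner pair and collapses to the zero vector.\<close>
      let ?y = "\<lambda>i. w i + unit_vec 0 i"
      have "?y \<notin> ?T"
        by (simp add: inner_pairs_def unit_vec_def)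
      then have "c ?y \<in> P"
        using P(1) by (simp add: c_def)
      moreover have "factorization_hom S ?y = factorization_hom S x"
        using w s embedding_dim_pos
        by (simp add: factorization_hom_add factorization_hom_unit_vec atom_0)
      moreover have "?y \<in> free_monoid ?e"
        using w embedding_dim_pos by (simp add: add_free unit_vec_free)
      ultimately show ?thesis by blast
    qed
    then obtain y where "y \<in> free_monoid ?e" "factorization_hom S y = factorization_hom S x"
      "c y \<in> P"
      by blast
    with K[of x y] free have "c x \<in> P"
      by (simp add: factorization_ker_def)
    with x show ?thesis
      by (simp add: c_def)
  qed
  then have "insert (\<lambda>_. 0) ?T \<subseteq> P"
    using P(1) by blast
  \<comment> \<open>The collapsed vertex contributes the successor, which cancels against the one in
    the bound for \<open>card P\<close>.\<close>
  then have "Suc (card ?T) \<le> card P"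
    using card_mono[OF P(2), of "insert (\<lambda>_. 0) ?T"] zero by (simp add: finite_inner_pairs)
  with P(3) cardE card_inner_pairs[of ?e] show ?thesis
    by linarith
qed

end

section \<open>The bound for \<open>eta\<close>\<close>

theorem theorem3p4:
  fixes S :: "nat set" and m e :: nat and r :: int
  assumes "numerical_semigroup S"
    and "m = semigroup_multiplicity S"
    and "e = embedding_dim S"
    and "r = int m - int e"
  shows "int (eta S) \<ge> int (e choose 2) - r"
proof -
  obtain \<rho> where \<rho>: "finite \<rho>" "presentation S \<rho>"
    using finite_presentation_exists[OF assms(1)] by blast
  \<comment> \<open>This is the very set whose cardinality defines \<open>eta\<close>. Existence of
    a minimal presentation makes it one, and comparison with the finite \<rho> makes it finite, so
    the graph bound applies.\<close>
  define \<sigma> where "\<sigma> = (SOME \<rho>. minimal_presentation S \<rho>)"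
  have \<sigma>: "minimal_presentation S \<sigma>"
    unfolding \<sigma>_def using finite_presentation_contains_minimal[OF \<rho>] by (rule someI_ex)
  then have "finite \<sigma>" "presentation S \<sigma>"
    using finite_minimal_presentation[OF \<rho>] by (auto simp: minimal_presentation_def)
  then have "e choose 2 \<le> card \<sigma> + card (inner_apery S)"
    using presentation_card_ge[OF assms(1)] assms(3) by simp
  moreover have "card (inner_apery S) + e \<le> m"
    using card_inner_apery[OF assms(1)] assms by simp
  moreover have "eta S = card \<sigma>"
    by (simp add: eta_def \<sigma>_def)
  ultimately show ?thesis
    using assms(4) by linarith
qed

end
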